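(* Let $G=(V,E,w)$ be an undirected graph with $n$ vertices and let $\{S_i\}_{i=1}^k$ be a $k$-way partition of $V$ achieving $\rho(k)$ with almost balanced clusters, i.e. $\frac12\mathrm{vol}(V)/k\le\mathrm{vol}(S_i)\le2\,\mathrm{vol}(V)/k$ for all $i$. Let $\ell\in[k]$ with $\ell<n$, suppose the meta-graph $M$ of $\{S_i\}$ is $(\theta,\ell)$-distinguishable, and suppose $\Psi(\ell)\le(2176(1+\mathsf{APT}))^{-1}\theta^3$. Let $\{A_i\}_{i=1}^k$ be the output of spectral clustering with $\ell$ eigenvectors using a $k$-means algorithm of approximation ratio $\mathsf{APT}$. Then there is a permutation $\pi$ of $[k]$ such that $$\sum_{i=1}^k\mathrm{vol}(A_i\,\triangle\,S_{\pi(i)})\le 2176(1+\mathsf{APT})\,\frac{\Psi(\ell)\cdot\mathrm{vol}(V)}{k\cdot\theta^2}.$$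
   Context: $G$ has nonnegative edge weights, $\deg(u)=\sum_v w_{uv}>0$, $w(S,T)$ = total weight of edges between $S$ and $T$ (for $S=T$, the total weight of edges inside $S$), $\mathrm{vol}(S)=\sum_{u\in S}\deg(u)$, $\Phi(S)=w(S,V\setminus S)/\mathrm{vol}(S)$, $\rho(k)=\min\max_i\Phi(A_i)$ over partitions of $V$ into $k$ disjoint sets. $\mathcal N_G=I-D^{-1/2}AD^{-1/2}$ has eigenvalues $\lambda_1\le\cdots\le\lambda_n$, orthonormal eigenvectors $f_1,\ldots,f_n$. Meta-graph $M$: the graph on vertex set $[k]$ with adjacency matrix $A_M(i,j)=w(S_i,S_j)$ for $i\ne j$ and $A_M(i,i)=2w(S_i,S_i)$; $\mathcal N_M=I-D_M^{-1/2}A_MD_M^{-1/2}$ ($D_M$ its degree matrix) has eigenvalues $\gamma_1\le\cdots\le\gamma_k$ with orthonormal eigenvectors $g_1,\ldots,g_k\in\mathbb{R}^k$. For $i\in[k]$ let $\bar x^{(i)}=(g_1(i),\ldots,g_\ell(i))^\intercal$. $M$ is $(\theta,\ell)$-distinguishable ($\theta>0$) if $\|\bar x^{(i)}\|^2\ge\theta$ for all $i$ and $\|\bar x^{(i)}/\|\bar x^{(i)}\|-\bar x^{(j)}/\|\bar x^{(j)}\|\|^2\ge\theta$ for all $i\ne j$. $\Psi(\ell)=\sum_{i=1}^\ell\gamma_i/\lambda_{\ell+1}$. Spectral clustering with $\ell$ eigenvectors: embed $u$ as $F(u)=\deg(u)^{-1/2}(f_1(u),\ldots,f_\ell(u))^\intercal\in\mathbb{R}^\ell$,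 and run a $k$-means algorithm with approximation ratio $\mathsf{APT}$ (returning a partition whose cost $\sum_i\sum_{u\in B_i}\deg(u)\|F(u)-c_i\|^2$, with $c_i$ the degree-weighted mean of $F$ over $B_i$, is at most $\mathsf{APT}$ times the minimum) into $k$ clusters $A_1,\ldots,A_k$. $X\triangle Y$ is the symmetric difference. *)

theory Defs
  imports "HOL-Analysis.Analysis" "HOL-Library.Disjoint_Sets"
begin

text \<open>
  A weighted undirected graph on the vertex type \<open>'v\<close> is given by its adjacency matrix \<open>w\<close>.
  Self-loops are permitted; as for the meta-graph below, a diagonal entry of the adjacency matrix
  is twice the weight of the loop. For loop-free graphs the diagonal is zero.
\<close>

definition deg :: "('v::finite \<Rightarrow> 'v \<Rightarrow> real) \<Rightarrow> 'v \<Rightarrow> real" where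
  "deg w u = (\<Sum>v\<in>UNIV. w u v)"

definition weighted_graph :: "('v::finite \<Rightarrow> 'v \<Rightarrow> real) \<Rightarrow> bool" where
  "weighted_graph w \<longleftrightarrow>
     (\<forall>u v. w u v = w v u) \<and> (\<forall>u v. 0 \<le> w u v) \<and> (\<forall>u. 0 < deg w u)"

definition vol :: "('v::finite \<Rightarrow> 'v \<Rightarrow> real) \<Rightarrow> 'v set \<Rightarrow> real" where
  "vol w S = (\<Sum>u\<in>S. deg w u)"

text \<open>
  Used only for disjoint \<open>S\<close>, \<open>T\<close> and for \<open>S = T\<close>; in the latter case the double sum meets every
  edge inside \<open>S\<close> twice.
\<close>

definition edge_weight :: "('v::finite \<Rightarrow> 'v \<Rightarrow> real) \<Rightarrow> 'v set \<Rightarrow> 'v set \<Rightarrow> real" where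
  "edge_weight w S T =
     (if S = T then (\<Sum>u\<in>S. \<Sum>v\<in>S. w u v) / 2 else (\<Sum>u\<in>S. \<Sum>v\<in>T. w u v))"

definition conductance :: "('v::finite \<Rightarrow> 'v \<Rightarrow> real) \<Rightarrow> 'v set \<Rightarrow> real" where
  "conductance w S = edge_weight w S (UNIV - S) / vol w S"

definition kway_partitions :: "nat \<Rightarrow> 'v set set set" where
  "kway_partitions k = {P. partition_on UNIV P \<and> card P = k}"

definition rho :: "('v::finite \<Rightarrow> 'v \<Rightarrow> real) \<Rightarrow> nat \<Rightarrow> real" where
  "rho w k = Min ((\<lambda>P. Max (conductance w ` P)) ` kway_partitions k)"

text \<open>A \<open>k\<close>-way partition indexed by \<open>[k]\<close>, the index set being the type \<open>'k\<close> with \<open>k = CARD('k)\<close>.\<close>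

definition indexed_partition :: "('k::finite \<Rightarrow> 'v::finite set) \<Rightarrow> bool" where
  "indexed_partition S \<longleftrightarrow> inj S \<and> range S \<in> kway_partitions CARD('k)"

definition adjacency_matrix :: "('v::finite \<Rightarrow> 'v \<Rightarrow> real) \<Rightarrow> real^'v^'v" where
  "adjacency_matrix w = (\<chi> u v. w u v)"

definition inv_sqrt_degree_matrix :: "('v::finite \<Rightarrow> 'v \<Rightarrow> real) \<Rightarrow> real^'v^'v" where
  "inv_sqrt_degree_matrix w = (\<chi> u v. if u = v then 1 / sqrt (deg w u) else 0)"

definition normalised_laplacian :: "('v::finite \<Rightarrow> 'v \<Rightarrow> real) \<Rightarrow> real^'v^'v" where
  "normalised_laplacian w =
     mat 1 - inv_sqrt_degree_matrix w ** adjacency_matrix w ** inv_sqrt_degree_matrix w"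

text \<open>
  \<open>ev 1 \<le> \<dots> \<le> ev n\<close> are the eigenvalues of the \<open>n \<times> n\<close> matrix \<open>N\<close>, with multiplicity, and
  \<open>f 1, \<dots>, f n\<close> are corresponding orthonormal eigenvectors. Values at other indices are irrelevant.
\<close>

definition orthonormal_eigensystem ::
    "real^'n^'n \<Rightarrow> (nat \<Rightarrow> real) \<Rightarrow> (nat \<Rightarrow> real^'n) \<Rightarrow> bool" where
  "orthonormal_eigensystem N ev f \<longleftrightarrow>
     mono_on {1..CARD('n)} ev \<and>
     (\<forall>i\<in>{1..CARD('n)}. N *v f i = ev i *\<^sub>R f i) \<and>
     (\<forall>i\<in>{1..CARD('n)}. \<forall>j\<in>{1..CARD('n)}. f i \<bullet> f j = (if i = j then 1 else 0))"

definition meta_graph ::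
    "('v::finite \<Rightarrow> 'v \<Rightarrow> real) \<Rightarrow> ('k::finite \<Rightarrow> 'v set) \<Rightarrow> 'k \<Rightarrow> 'k \<Rightarrow> real" where
  "meta_graph w S i j =
     (if i = j then 2 * edge_weight w (S i) (S i) else edge_weight w (S i) (S j))"

text \<open>
  Vectors in \<open>\<real>\<^sup>l\<close> are functions \<open>nat \<Rightarrow> real\<close> restricted to the coordinates \<open>{1..l}\<close>; their
  Euclidean norm is \<open>L2_set x {1..l}\<close>.
\<close>

definition meta_embedding :: "(nat \<Rightarrow> real^'k) \<Rightarrow> 'k::finite \<Rightarrow> nat \<Rightarrow> real" where
  "meta_embedding g i = (\<lambda>m. g m $ i)"

definition distinguishable :: "real \<Rightarrow> nat \<Rightarrow> (nat \<Rightarrow> real^'k::finite) \<Rightarrow> bool" where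
  "distinguishable \<theta> l g \<longleftrightarrow>
     \<theta> > 0 \<and>
     (\<forall>i. (L2_set (meta_embedding g i) {1..l})\<^sup>2 \<ge> \<theta>) \<and>
     (\<forall>i j. i \<noteq> j \<longrightarrow>
        (L2_set (\<lambda>m. meta_embedding g i m / L2_set (meta_embedding g i) {1..l}
                   - meta_embedding g j m / L2_set (meta_embedding g j) {1..l}) {1..l})\<^sup>2 \<ge> \<theta>)"

text \<open>Meaningful only for \<open>lam (l + 1) \<noteq> 0\<close>.\<close>

definition Psi :: "(nat \<Rightarrow> real) \<Rightarrow> (nat \<Rightarrow> real) \<Rightarrow> nat \<Rightarrow> real" where
  "Psi lam gam l = (\<Sum>i=1..l. gam i / lam (l + 1))"

definition spectral_embedding ::
    "('v::finite \<Rightarrow> 'v \<Rightarrow> real) \<Rightarrow> (nat \<Rightarrow> real^'v) \<Rightarrow> 'v \<Rightarrow> nat \<Rightarrow> real" where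
  "spectral_embedding w f u = (\<lambda>m. f m $ u / sqrt (deg w u))"

definition weighted_mean ::
    "('v::finite \<Rightarrow> 'v \<Rightarrow> real) \<Rightarrow> ('v \<Rightarrow> nat \<Rightarrow> real) \<Rightarrow> 'v set \<Rightarrow> nat \<Rightarrow> real" where
  "weighted_mean w F B = (\<lambda>m. (\<Sum>u\<in>B. deg w u * F u m) / vol w B)"

definition kmeans_cost ::
    "('v::finite \<Rightarrow> 'v \<Rightarrow> real) \<Rightarrow> nat \<Rightarrow> ('v \<Rightarrow> nat \<Rightarrow> real) \<Rightarrow> 'v set set \<Rightarrow> real" where
  "kmeans_cost w l F P =
     (\<Sum>B\<in>P. \<Sum>u\<in>B. deg w u * (L2_set (\<lambda>m. F u m - weighted_mean w F B m) {1..l})\<^sup>2)"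

definition kmeans_opt ::
    "('v::finite \<Rightarrow> 'v \<Rightarrow> real) \<Rightarrow> nat \<Rightarrow> ('v \<Rightarrow> nat \<Rightarrow> real) \<Rightarrow> nat \<Rightarrow> real" where
  "kmeans_opt w l F k = Min (kmeans_cost w l F ` kway_partitions k)"

text \<open>
  \<open>A\<close> is a possible output of spectral clustering with the eigenvectors \<open>f 1, \<dots>, f l\<close> and a
  \<open>k\<close>-means algorithm of approximation ratio \<open>APT\<close>: the algorithm enters only through its guarantee.
\<close>

definition spectral_clustering_output ::
    "('v::finite \<Rightarrow> 'v \<Rightarrow> real) \<Rightarrow> (nat \<Rightarrow> real^'v) \<Rightarrow> nat \<Rightarrow> real \<Rightarrow> ('k::finite \<Rightarrow> 'v set) \<Rightarrow> bool" where
  "spectral_clustering_output w f l APT A \<longleftrightarrow>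
     indexed_partition A \<and>
     kmeans_cost w l (spectral_embedding w f) (range A)
       \<le> APT * kmeans_opt w l (spectral_embedding w f) CARD('k)"

end

theory Submission
  imports Defs
begin

text \<open>
  Spread the eigenvectors \<open>g 1, \<dots>, g l\<close> of the meta-graph over \<open>V\<close>, proportionally to the square root of
  the degree on every cluster. This is an isometry preserving the Laplacian quadratic form, so the lifts
  are orthonormal with Rayleigh quotients \<open>\<gamma>\<^sub>j\<close>, and their total squared distance to the span of
  \<open>f 1, \<dots>, f l\<close> is at most \<open>\<Psi>\<close>. By symmetry of this distance, \<open>f 1, \<dots>, f l\<close> are equally close to the
  span of the lifts; hence the \<open>k\<close>-means cost of \<open>S\<close> with suitable centres \<open>p\<^sub>i\<close> is at most \<open>\<Psi>\<close>, while
  distinguishability, the upper volume bounds and \<open>\<Psi> \<le> 1/2\<close> give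
  \<open>\<parallel>p\<^sub>i - p\<^sub>j\<parallel>\<^sup>2 \<ge> k \<theta>\<^sup>2 / (16 vol V)\<close>.

  Send every \<open>A\<^sub>i\<close> to the cluster whose \<open>p\<^sub>j\<close> is nearest to the mean of \<open>A\<^sub>i\<close>. A vertex whose own cluster is
  a different one is far from its centre \<open>p\<close> or from the mean of its \<open>A\<^sub>i\<close>, which bounds the misclassified
  volume by \<open>128 (1 + APT) \<Psi> vol V / (k \<theta>\<^sup>2)\<close>. The hypothesis on \<open>\<Psi>\<close> makes this smaller than every
  \<open>vol S\<^sub>j\<close>, so no cluster can be missed and the assignment is a permutation.
\<close>

section \<open>Matching two clusterings\<close>

lemma L2_set_power2: "(L2_set x I)\<^sup>2 = (\<Sum>m\<in>I. (x m)\<^sup>2)"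
  by (simp add: L2_set_def sum_nonneg)

lemma L2_set_scale: "L2_set (\<lambda>m. r * x m) I = \<bar>r\<bar> * L2_set x I"
  by (simp add: L2_set_def power_mult_distrib real_sqrt_mult flip: sum_distrib_left)

lemma sq_dist_quasi_triangle:
  "(L2_set (\<lambda>m. x m - z m) I)\<^sup>2
     \<le> 2 * (L2_set (\<lambda>m. x m - y m) I)\<^sup>2 + 2 * (L2_set (\<lambda>m. y m - z m) I)\<^sup>2"
proof -
  \<comment> \<open>The slack is exactly \<open>(x m - 2 * y m + z m)\<^sup>2\<close>.\<close>
  have "(x m - z m)\<^sup>2 \<le> 2 * (x m - y m)\<^sup>2 + 2 * (y m - z m)\<^sup>2" for m
    using sum_squares_ge_zero[of "x m - 2 * y m + z m" 0]
    by (simp add: power2_eq_square algebra_simps)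
  then show ?thesis
    by (simp add: L2_set_power2 sum_distrib_left sum_mono flip: sum.distrib)
qed

lemma sq_dist_commute: "(L2_set (\<lambda>m. x m - y m) I)\<^sup>2 = (L2_set (\<lambda>m. y m - x m) I)\<^sup>2"
  by (simp add: L2_set_power2 power2_commute)

text \<open>One-sided Dunkl-Williams inequality: scaled by the norm of \<open>a\<close>, the
  difference of the unit vectors is \<open>a - b\<close> plus a multiple of \<open>b\<close> whose
  length is the difference of the two norms, itself at most the norm of
  \<open>a - b\<close>.\<close>

lemma L2_set_dunkl_williams:
  assumes "0 < L2_set a I" "0 < L2_set b I"
  shows "L2_set a I * L2_set (\<lambda>m. a m / L2_set a I - b m / L2_set b I) I
           \<le> 2 * L2_set (\<lambda>m. a m - b m) I"
proof -
  define \<alpha> where "\<alpha> = L2_set a I"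
  define \<beta> where "\<beta> = L2_set b I"
  define \<delta> where "\<delta> = L2_set (\<lambda>m. a m - b m) I"
  have pos: "0 < \<alpha>" "0 < \<beta>"
    using assms by (auto simp: \<alpha>_def \<beta>_def)
  have 1: "\<alpha> \<le> \<delta> + \<beta>"
    using L2_set_triangle_ineq[of "\<lambda>m. a m - b m" b I] by (simp add: \<alpha>_def \<beta>_def \<delta>_def)
  have "\<delta> = L2_set (\<lambda>m. b m - a m) I"
    by (simp add: \<delta>_def L2_set_def power2_commute)
  then have 2: "\<beta> \<le> \<delta> + \<alpha>"
    using L2_set_triangle_ineq[of "\<lambda>m. b m - a m" a I] by (simp add: \<alpha>_def \<beta>_def)
  have "\<alpha> * L2_set (\<lambda>m. a m / \<alpha> - b m / \<beta>) I
      = L2_set (\<lambda>m. \<alpha> * (a m / \<alpha> - b m / \<beta>)) I"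
    using pos by (simp add: L2_set_right_distrib)
  also have "\<dots> = L2_set (\<lambda>m. (a m - b m) + (\<beta> - \<alpha>) / \<beta> * b m) I"
    using pos by (intro L2_set_cong) (auto simp: field_simps)
  also have "\<dots> \<le> \<delta> + L2_set (\<lambda>m. (\<beta> - \<alpha>) / \<beta> * b m) I"
    unfolding \<delta>_def by (rule L2_set_triangle_ineq)
  also have "L2_set (\<lambda>m. (\<beta> - \<alpha>) / \<beta> * b m) I = \<bar>(\<beta> - \<alpha>) / \<beta>\<bar> * \<beta>"
    unfolding L2_set_scale by (simp add: \<beta>_def)
  also have "\<dots> = \<bar>\<beta> - \<alpha>\<bar>"
    using pos by simp
  finally show ?thesis
    using 1 2 unfolding \<alpha>_def \<beta>_def \<delta>_def by linarith
qed

text \<open>Every misplaced point pays at least \<open>\<Delta> / 8\<close> times its weight in the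
  two costs together. The centres \<open>c\<close> and \<open>p\<close> are arbitrary, so the means
  of one clustering can be compared with idealised centres of the other.\<close>

lemma matching_of_clusterings:
  fixes a s :: "'v::finite \<Rightarrow> 'k::finite" and d :: "'v \<Rightarrow> real"
    and F :: "'v \<Rightarrow> 'i \<Rightarrow> real" and c p :: "'k \<Rightarrow> 'i \<Rightarrow> real"
  assumes d: "\<And>u. 0 \<le> d u" and \<Delta>: "0 < \<Delta>"
    and cost_s: "(\<Sum>u\<in>UNIV. d u * (L2_set (\<lambda>m. F u m - p (s u) m) I)\<^sup>2) \<le> X"
    and cost_a: "(\<Sum>u\<in>UNIV. d u * (L2_set (\<lambda>m. F u m - c (a u) m) I)\<^sup>2) \<le> Y"
    and sep: "\<And>i j. i \<noteq> j \<Longrightarrow> \<Delta> \<le> (L2_set (\<lambda>m. p i m - p j m) I)\<^sup>2"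
    and large: "\<And>j. 8 * (X + Y) / \<Delta> < (\<Sum>u | s u = j. d u)"
  shows "\<exists>\<pi>. \<pi> permutes (UNIV :: 'k set) \<and> (\<Sum>u | s u \<noteq> \<pi> (a u). d u) \<le> 8 * (X + Y) / \<Delta>"
proof -
  define D where "D x y = (L2_set (\<lambda>m. x m - y m) I)\<^sup>2" for x y :: "'i \<Rightarrow> real"
  have D_comm: "D x y = D y x" and D_tri: "D x z \<le> 2 * D x y + 2 * D y z"
    and D_pos: "0 \<le> D x y" for x y z
    unfolding D_def by (rule sq_dist_commute, rule sq_dist_quasi_triangle, simp)
  have "\<exists>j. \<forall>j'. D (p j) (c i) \<le> D (p j') (c i)" for i
  proof -
    have "Min (range (\<lambda>j. D (p j) (c i))) \<in> range (\<lambda>j. D (p j) (c i))"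
      by (rule Min_in) auto
    then obtain j where "Min (range (\<lambda>j. D (p j) (c i))) = D (p j) (c i)"
      by (rule imageE)
    moreover have "Min (range (\<lambda>j. D (p j) (c i))) \<le> D (p j') (c i)" for j'
      by (rule Min_le) auto
    ultimately show ?thesis
      by auto
  qed
  then have "\<forall>i. \<exists>j. \<forall>j'. D (p j) (c i) \<le> D (p j') (c i)" ..
  from choice[OF this] obtain \<pi> where \<pi>: "D (p (\<pi> i)) (c i) \<le> D (p j) (c i)" for i j
    by blast
  have wrong: "\<Delta> \<le> 8 * (D (F u) (p (s u)) + D (F u) (c (a u)))" if "s u \<noteq> \<pi> (a u)" for u
  proof -
    have "\<Delta> \<le> D (p (s u)) (p (\<pi> (a u)))"
      using sep[OF that] by (simp add: D_def)
    also have "\<dots> \<le> 2 * D (p (s u)) (c (a u)) + 2 * D (p (\<pi> (a u))) (c (a u))"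
      by (metis D_comm D_tri)
    \<comment> \<open>The choice of \<open>\<pi>\<close> makes the second distance at most the
      first; one more quasi-triangle through \<open>F u\<close> yields the factor 8.\<close>
    also have "\<dots> \<le> 4 * D (p (s u)) (c (a u))"
      using \<pi>[of "a u" "s u"] by simp
    also have "\<dots> \<le> 4 * (2 * D (F u) (p (s u)) + 2 * D (F u) (c (a u)))"
      by (intro mult_left_mono) (metis D_comm D_tri, simp)
    finally show ?thesis by simp
  qed
  have "\<Delta> * (\<Sum>u | s u \<noteq> \<pi> (a u). d u)
      \<le> (\<Sum>u | s u \<noteq> \<pi> (a u). 8 * (d u * D (F u) (p (s u)) + d u * D (F u) (c (a u))))"
    unfolding sum_distrib_left
  proof (rule sum_mono)
    fix u assume "u \<in> {u. s u \<noteq> \<pi> (a u)}"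
    then have "d u * \<Delta> \<le> d u * (8 * (D (F u) (p (s u)) + D (F u) (c (a u))))"
      using wrong[of u] d[of u] by (intro mult_left_mono) auto
    then show "\<Delta> * d u \<le> 8 * (d u * D (F u) (p (s u)) + d u * D (F u) (c (a u)))"
      by (simp add: algebra_simps)
  qed
  also have "\<dots> \<le> (\<Sum>u\<in>UNIV. 8 * (d u * D (F u) (p (s u)) + d u * D (F u) (c (a u))))"
    using d D_pos by (intro sum_mono2) auto
  also have "\<dots> = 8 * ((\<Sum>u\<in>UNIV. d u * D (F u) (p (s u))) + (\<Sum>u\<in>UNIV. d u * D (F u) (c (a u))))"
    by (simp add: sum_distrib_left sum.distrib)
  also have "\<dots> \<le> 8 * (X + Y)"
    using cost_s cost_a by (simp add: D_def)
  finally have mis: "(\<Sum>u | s u \<noteq> \<pi> (a u). d u) \<le> 8 * (X + Y) / \<Delta>"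
    using \<Delta> by (simp add: field_simps)
  \<comment> \<open>A cluster missed by \<open>\<pi>\<close> would consist of misclassified points only.\<close>
  have "surj \<pi>"
  proof (rule ccontr)
    assume "\<not> surj \<pi>"
    then obtain j where "\<forall>i. \<pi> i \<noteq> j"
      by (metis surjI)
    then have "(\<Sum>u | s u = j. d u) \<le> (\<Sum>u | s u \<noteq> \<pi> (a u). d u)"
      using d by (intro sum_mono2) auto
    then show False
      using large[of j] mis by linarith
  qed
  then have "\<pi> permutes UNIV"
    using finite_UNIV_surj_inj[OF finite, of \<pi>] by (auto simp: permutes_altdef bij_def)
  then show ?thesis
    using mis by blast
qed

text \<open>Double counting: \<open>u\<close> lies in the symmetric difference only for
  \<open>i = a u\<close> and \<open>i = inv \<pi> (s u)\<close>, and for neither when these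
  coincide.\<close>

lemma sum_weight_sym_diff_le:
  fixes a s :: "'v::finite \<Rightarrow> 'k::finite" and d :: "'v \<Rightarrow> real"
  assumes d: "\<And>u. 0 \<le> d u" and \<pi>: "\<pi> permutes UNIV"
  shows "(\<Sum>i\<in>UNIV. \<Sum>u\<in>sym_diff {u. a u = i} {u. s u = \<pi> i}. d u)
           \<le> 2 * (\<Sum>u | s u \<noteq> \<pi> (a u). d u)"
proof -
  have "(\<Sum>i\<in>UNIV. \<Sum>u\<in>sym_diff {u. a u = i} {u. s u = \<pi> i}. d u)
      = (\<Sum>i\<in>UNIV. \<Sum>u\<in>UNIV. if (a u = i) \<noteq> (s u = \<pi> i) then d u else 0)"
    by (intro sum.cong[OF refl], subst sum.inter_filter[symmetric]) (auto intro!: sum.cong)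
  also have "\<dots> = (\<Sum>u\<in>UNIV. \<Sum>i\<in>UNIV. if (a u = i) \<noteq> (s u = \<pi> i) then d u else 0)"
    by (rule sum.swap)
  also have "\<dots> \<le> (\<Sum>u\<in>UNIV. if s u \<noteq> \<pi> (a u) then 2 * d u else 0)"
  proof (rule sum_mono)
    fix u
    have eq: "(\<Sum>i\<in>UNIV. if (a u = i) \<noteq> (s u = \<pi> i) then d u else 0)
        = real (card {i. (a u = i) \<noteq> (s u = \<pi> i)}) * d u"
      by (subst sum.inter_filter[symmetric]) auto
    have inv: "s u = \<pi> i \<longleftrightarrow> i = inv \<pi> (s u)" for i
      using permutes_inverses[OF \<pi>] by metis
    show "(\<Sum>i\<in>UNIV. if (a u = i) \<noteq> (s u = \<pi> i) then d u else 0)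
        \<le> (if s u \<noteq> \<pi> (a u) then 2 * d u else 0)"
    proof (cases "s u = \<pi> (a u)")
      case True
      then have "{i. (a u = i) \<noteq> (s u = \<pi> i)} = {}"
        by (auto simp: inv)
      then show ?thesis
        using True unfolding eq by simp
    next
      case False
      have "card {i. (a u = i) \<noteq> (s u = \<pi> i)} \<le> card {a u, inv \<pi> (s u)}"
        by (intro card_mono) (auto simp: inv)
      also have "\<dots> \<le> 2"
        by (simp add: card_insert_if)
      finally show ?thesis
        using False d[of u] unfolding eq by (simp add: mult_right_mono)
    qed
  qed
  also have "\<dots> = 2 * (\<Sum>u | s u \<noteq> \<pi> (a u). d u)"
    by (subst sum.inter_filter[symmetric]) (auto simp: sum_distrib_left)
  finally show ?thesis .
qed

section \<open>Orthonormal eigensystems\<close>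

text \<open>Orthonormal vectors are independent, and as many as the dimension of them span the whole
  space.\<close>

lemma orthonormal_expansion:
  fixes f :: "nat \<Rightarrow> real^'n"
  assumes "\<And>i j. i \<in> {1..CARD('n)} \<Longrightarrow> j \<in> {1..CARD('n)} \<Longrightarrow> f i \<bullet> f j = (if i = j then 1 else 0)"
  shows "(\<Sum>m=1..CARD('n). (f m \<bullet> x) *\<^sub>R f m) = x"
proof -
  let ?I = "{1..CARD('n)}"
  have inj: "inj_on f ?I"
    using assms by (intro inj_onI) (metis zero_neq_one)
  have orth: "pairwise orthogonal (f ` ?I)"
    using assms by (auto simp: pairwise_def orthogonal_def)
  have norm1: "norm y = 1" if "y \<in> f ` ?I" for y
    using that assms by (auto simp: norm_eq_sqrt_inner)
  have "independent (f ` ?I)"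
    using orth norm1 by (intro pairwise_orthogonal_independent) force+
  then have "x \<in> span (f ` ?I)"
    using card_ge_dim_independent[of "f ` ?I" UNIV] card_image[OF inj] by (auto simp: subset_iff)
  from orthonormal_basis_expand[OF orth norm1 this] have "(\<Sum>m\<in>?I. (x \<bullet> f m) *\<^sub>R f m) = x"
    unfolding sum.reindex[OF inj] by simp
  then show ?thesis
    by (simp only: inner_commute[of x])
qed

lemma orthonormal_parseval:
  fixes f :: "nat \<Rightarrow> real^'n"
  assumes "\<And>i j. i \<in> {1..CARD('n)} \<Longrightarrow> j \<in> {1..CARD('n)} \<Longrightarrow> f i \<bullet> f j = (if i = j then 1 else 0)"
  shows "(\<Sum>m=1..CARD('n). (f m \<bullet> x)\<^sup>2) = x \<bullet> x"
proof -
  have "x \<bullet> x = (\<Sum>m=1..CARD('n). (f m \<bullet> x) *\<^sub>R f m) \<bullet> x"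
    by (simp only: orthonormal_expansion[OF assms])
  then show ?thesis
    by (simp add: inner_sum_left power2_eq_square)
qed

lemma eigensystem_rayleigh:
  fixes f :: "nat \<Rightarrow> real^'n"
  assumes "orthonormal_eigensystem N ev f"
  shows "x \<bullet> (N *v x) = (\<Sum>m=1..CARD('n). ev m * (f m \<bullet> x)\<^sup>2)"
proof -
  have on: "\<And>i j. i \<in> {1..CARD('n)} \<Longrightarrow> j \<in> {1..CARD('n)} \<Longrightarrow> f i \<bullet> f j = (if i = j then 1 else 0)"
    and ev: "\<And>i. i \<in> {1..CARD('n)} \<Longrightarrow> N *v f i = ev i *\<^sub>R f i"
    using assms by (auto simp: orthonormal_eigensystem_def)
  have "N *v x = N *v (\<Sum>m=1..CARD('n). (f m \<bullet> x) *\<^sub>R f m)"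
    by (simp only: orthonormal_expansion[OF on])
  also have "\<dots> = (\<Sum>m=1..CARD('n). (f m \<bullet> x) *\<^sub>R (N *v f m))"
    by (simp add: linear_sum[OF matrix_vector_mul_linear] linear_scale[OF matrix_vector_mul_linear])
  also have "\<dots> = (\<Sum>m=1..CARD('n). (ev m * (f m \<bullet> x)) *\<^sub>R f m)"
    by (intro sum.cong refl) (simp add: ev)
  finally show ?thesis
    by (simp add: inner_sum_right power2_eq_square inner_commute mult.assoc)
qed

text \<open>In the eigenbasis expansion of the quadratic form, terms beyond \<open>l\<close> have
  eigenvalue at least \<open>ev (l + 1)\<close>, and the other terms are nonnegative.\<close>

lemma eigensystem_tail_le:
  fixes f :: "nat \<Rightarrow> real^'n"
  assumes es: "orthonormal_eigensystem N ev f" and psd: "\<And>x. 0 \<le> x \<bullet> (N *v x)"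
    and l: "l < CARD('n)" and pos: "0 < ev (l + 1)"
  shows "(\<Sum>m=l+1..CARD('n). (f m \<bullet> x)\<^sup>2) \<le> (x \<bullet> (N *v x)) / ev (l + 1)"
proof -
  let ?I = "{1..CARD('n)}"
  have mono: "mono_on ?I ev"
    and on: "\<And>i. i \<in> ?I \<Longrightarrow> f i \<bullet> f i = 1" and ev: "\<And>i. i \<in> ?I \<Longrightarrow> N *v f i = ev i *\<^sub>R f i"
    using es by (auto simp: orthonormal_eigensystem_def)
  have nonneg: "0 \<le> ev i" if "i \<in> ?I" for i
    using psd[of "f i"] that by (simp add: ev on)
  have "ev (l + 1) * (\<Sum>m=l+1..CARD('n). (f m \<bullet> x)\<^sup>2)
      \<le> (\<Sum>m=l+1..CARD('n). ev m * (f m \<bullet> x)\<^sup>2)"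
    unfolding sum_distrib_left using l
    by (intro sum_mono mult_right_mono mono_onD[OF mono]) auto
  also have "\<dots> \<le> (\<Sum>m\<in>?I. ev m * (f m \<bullet> x)\<^sup>2)"
    using nonneg by (intro sum_mono2) auto
  also have "\<dots> = x \<bullet> (N *v x)"
    by (rule eigensystem_rayleigh[OF es, symmetric])
  finally show ?thesis
    using pos by (simp add: field_simps)
qed

lemma eigensystem_head_tail:
  fixes f :: "nat \<Rightarrow> real^'n"
  assumes es: "orthonormal_eigensystem N ev f" and l: "l < CARD('n)"
  shows "(\<Sum>m=1..l. (f m \<bullet> x)\<^sup>2) + (\<Sum>m=l+1..CARD('n). (f m \<bullet> x)\<^sup>2) = x \<bullet> x"
proof -
  have "(\<Sum>m=1..l. (f m \<bullet> x)\<^sup>2) + (\<Sum>m=l+1..CARD('n). (f m \<bullet> x)\<^sup>2) = (\<Sum>m=1..CARD('n). (f m \<bullet> x)\<^sup>2)"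
    using l by (subst sum.union_disjoint[symmetric]) (auto intro!: sum.cong)
  also have "\<dots> = x \<bullet> x"
    using es by (intro orthonormal_parseval) (auto simp: orthonormal_eigensystem_def)
  finally show ?thesis .
qed

section \<open>Labelled partitions and the meta-graph\<close>

text \<open>Clusters become the fibres of a label map, so that sums over clusters turn into sums
  over vertices; surjectivity records that no cluster is empty.\<close>

lemma indexed_partition_labelling:
  fixes S :: "'k::finite \<Rightarrow> 'v::finite set"
  assumes "indexed_partition S"
  obtains s where "S = (\<lambda>i. {u. s u = i})" and "surj s"
proof -
  have inj: "inj S" and U: "\<Union> (range S) = UNIV" and disj: "disjoint (range S)"
    and ne: "{} \<notin> range S"
    using assms by (auto simp: indexed_partition_def kway_partitions_def partition_on_def)
  have "\<exists>i. u \<in> S i" for u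
    using U by blast
  then obtain s where s: "u \<in> S (s u)" for u
    by metis
  have *: "u \<in> S i \<longleftrightarrow> s u = i" for u i
  proof
    assume "u \<in> S i"
    then have "S i = S (s u)"
      using s[of u] disj by (auto simp: pairwise_def disjnt_def)
    then show "s u = i"
      using inj by (auto dest: injD)
  qed (use s in auto)
  have "\<exists>u. u \<in> S i" for i
    using ne by (metis ex_in_conv rangeI)
  with * have "surj s"
    by (metis surjI surj_def)
  moreover have "S = (\<lambda>i. {u. s u = i})"
    using * by auto
  ultimately show thesis
    using that by blast
qed

lemma label_nonempty: "surj s \<Longrightarrow> {u. s u = i} \<noteq> {}"
  by (metis (mono_tags) empty_Collect_eq surjD)

lemma label_inj: "surj s \<Longrightarrow> inj (\<lambda>i. {u. s u = i})"
  by (intro injI) (metis (mono_tags) mem_Collect_eq surjD)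

lemma sum_by_label:
  fixes s :: "'v::finite \<Rightarrow> 'k::finite" and h :: "'v \<Rightarrow> real"
  shows "(\<Sum>i\<in>UNIV. \<Sum>u | s u = i. h u) = (\<Sum>u\<in>UNIV. h u)"
  using sum.group[of "UNIV :: 'v set" "UNIV :: 'k set" s h] by simp

section \<open>Costs of labelled clusterings in k-means\<close>

lemma kmeans_cost_by_label:
  fixes s :: "'v::finite \<Rightarrow> 'k::finite"
  assumes "surj s"
  shows "kmeans_cost w l F (range (\<lambda>i. {u. s u = i}))
    = (\<Sum>u\<in>UNIV. deg w u * (L2_set (\<lambda>m. F u m - weighted_mean w F {v. s v = s u} m) {1..l})\<^sup>2)"
proof -
  have "kmeans_cost w l F (range (\<lambda>i. {u. s u = i}))
    = (\<Sum>i\<in>UNIV. \<Sum>u | s u = i. deg w u * (L2_set (\<lambda>m. F u m - weighted_mean w F {v. s v = i} m) {1..l})\<^sup>2)"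
    \<comment> \<open>The cost sums over a set of clusters, so the passage to labels relies on
      distinct labels having distinct clusters.\<close>
    unfolding kmeans_cost_def by (subst sum.reindex[OF label_inj[OF assms]]) auto
  also have "\<dots> = (\<Sum>i\<in>UNIV. \<Sum>u | s u = i. deg w u * (L2_set (\<lambda>m. F u m - weighted_mean w F {v. s v = s u} m) {1..l})\<^sup>2)"
    by (intro sum.cong refl) auto
  finally show ?thesis
    by (simp only: sum_by_label)
qed

text \<open>Expanding around the mean in each coordinate, the cross term vanishes because weighted
  deviations from the mean sum to zero; what remains is \<open>vol w B\<close> times a
  square.\<close>

lemma weighted_mean_minimises:
  fixes w :: "'v::finite \<Rightarrow> 'v \<Rightarrow> real"
  assumes "0 < vol w B"
  shows "(\<Sum>u\<in>B. deg w u * (L2_set (\<lambda>m. F u m - weighted_mean w F B m) I)\<^sup>2)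
    \<le> (\<Sum>u\<in>B. deg w u * (L2_set (\<lambda>m. F u m - q m) I)\<^sup>2)"
proof -
  define c where "c = weighted_mean w F B"
  have coord: "(\<Sum>u\<in>B. deg w u * (F u m - c m)\<^sup>2) \<le> (\<Sum>u\<in>B. deg w u * (F u m - q m)\<^sup>2)" for m
  proof -
    have "vol w B * c m = (\<Sum>u\<in>B. deg w u * F u m)"
      using assms by (simp add: c_def weighted_mean_def)
    then have zero: "(\<Sum>u\<in>B. deg w u * (F u m - c m)) = 0"
      by (simp add: vol_def algebra_simps sum_subtractf sum_distrib_left)
    have "(\<Sum>u\<in>B. deg w u * (F u m - q m)\<^sup>2)
        = (\<Sum>u\<in>B. deg w u * (F u m - c m)\<^sup>2 + 2 * (c m - q m) * (deg w u * (F u m - c m))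
              + deg w u * (c m - q m)\<^sup>2)"
      by (intro sum.cong refl) (simp add: power2_eq_square algebra_simps)
    also have "\<dots> = (\<Sum>u\<in>B. deg w u * (F u m - c m)\<^sup>2)
        + 2 * (c m - q m) * (\<Sum>u\<in>B. deg w u * (F u m - c m)) + vol w B * (c m - q m)\<^sup>2"
      by (simp add: sum.distrib sum_distrib_left sum_distrib_right vol_def)
    finally show ?thesis
      using zero assms by simp
  qed
  have swap: "(\<Sum>u\<in>B. deg w u * (L2_set (\<lambda>m. F u m - r m) I)\<^sup>2)
      = (\<Sum>m\<in>I. \<Sum>u\<in>B. deg w u * (F u m - r m)\<^sup>2)" for r
    unfolding L2_set_power2 sum_distrib_left by (rule sum.swap)
  show ?thesis
    unfolding swap c_def[symmetric] by (intro sum_mono coord)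
qed

lemma vol_pos:
  assumes "weighted_graph w" "B \<noteq> {}"
  shows "0 < vol w B"
  using assms unfolding vol_def weighted_graph_def by (intro sum_pos) auto

text \<open>Bounds the optimum through any centres \<open>q\<close>, in particular ones that are not
  means: replacing them by the means only lowers the cost.\<close>

lemma kmeans_opt_le:
  fixes s :: "'v::finite \<Rightarrow> 'k::finite"
  assumes w: "weighted_graph w" and s: "surj s" and part: "indexed_partition (\<lambda>i. {u. s u = i})"
  shows "kmeans_opt w l F CARD('k)
    \<le> (\<Sum>u\<in>UNIV. deg w u * (L2_set (\<lambda>m. F u m - q (s u) m) {1..l})\<^sup>2)"
proof -
  have "kmeans_opt w l F CARD('k) \<le> kmeans_cost w l F (range (\<lambda>i. {u. s u = i}))"
    unfolding kmeans_opt_def using part by (intro Min_le) (auto simp: indexed_partition_def)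
  also have "\<dots> = (\<Sum>i\<in>UNIV. \<Sum>u | s u = i.
      deg w u * (L2_set (\<lambda>m. F u m - weighted_mean w F {v. s v = s u} m) {1..l})\<^sup>2)"
    by (simp only: kmeans_cost_by_label[OF s] sum_by_label)
  also have "\<dots> = (\<Sum>i\<in>UNIV. \<Sum>u | s u = i.
      deg w u * (L2_set (\<lambda>m. F u m - weighted_mean w F {v. s v = i} m) {1..l})\<^sup>2)"
    by (intro sum.cong refl) auto
  also have "\<dots> \<le> (\<Sum>i\<in>UNIV. \<Sum>u | s u = i. deg w u * (L2_set (\<lambda>m. F u m - q i m) {1..l})\<^sup>2)"
    by (intro sum_mono weighted_mean_minimises vol_pos[OF w] label_nonempty[OF s])
  also have "\<dots> = (\<Sum>i\<in>UNIV. \<Sum>u | s u = i. deg w u * (L2_set (\<lambda>m. F u m - q (s u) m) {1..l})\<^sup>2)"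
    by (intro sum.cong refl) auto
  finally show ?thesis
    by (simp only: sum_by_label)
qed

section \<open>The quadratic form of the normalised Laplacian\<close>

lemma laplacian_quadratic_form:
  "x \<bullet> (normalised_laplacian w *v x) = (\<Sum>u\<in>UNIV. (x $ u)\<^sup>2)
     - (\<Sum>u\<in>UNIV. \<Sum>v\<in>UNIV. w u v * (x $ u / sqrt (deg w u)) * (x $ v / sqrt (deg w v)))"
proof -
  have N: "normalised_laplacian w $ u $ v
      = (if u = v then 1 else 0) - w u v / (sqrt (deg w u) * sqrt (deg w v))" for u v
    by (simp add: normalised_laplacian_def mat_def matrix_matrix_mult_def inv_sqrt_degree_matrix_def
        adjacency_matrix_def if_distrib[where f="\<lambda>x. x * _"] if_distrib[where f="\<lambda>x. _ * x"] cong: if_cong)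
  have "x \<bullet> (normalised_laplacian w *v x)
      = (\<Sum>u\<in>UNIV. \<Sum>v\<in>UNIV. (if u = v then (x $ u)\<^sup>2 else 0)
          - w u v * (x $ u / sqrt (deg w u)) * (x $ v / sqrt (deg w v)))"
    by (auto simp: inner_vec_def matrix_vector_mult_def N sum_distrib_left power2_eq_square
        algebra_simps intro!: sum.cong)
  then show ?thesis
    by (simp add: sum_subtractf)
qed

text \<open>By \<open>2 * y u * y v \<le> (y u)\<^sup>2 + (y v)\<^sup>2\<close> and symmetry of
  \<open>w\<close>, the adjacency form is at most the sum of \<open>deg w u * (y u)\<^sup>2\<close>,
  which is the squared norm of \<open>x\<close>.\<close>

lemma laplacian_psd:
  assumes w: "weighted_graph w"
  shows "0 \<le> x \<bullet> (normalised_laplacian w *v x)"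
proof -
  define y where "y u = x $ u / sqrt (deg w u)" for u
  have sym: "w u v = w v u" and nn: "0 \<le> w u v" and deg: "0 < deg w u" for u v
    using w by (auto simp: weighted_graph_def)
  have half: "(\<Sum>u\<in>UNIV. \<Sum>v\<in>UNIV. w u v * (y u)\<^sup>2) = (\<Sum>u\<in>UNIV. (x $ u)\<^sup>2)"
  proof (intro sum.cong refl)
    fix u
    have "(\<Sum>v\<in>UNIV. w u v * (y u)\<^sup>2) = deg w u * (y u)\<^sup>2"
      by (simp add: deg_def sum_distrib_right)
    also have "\<dots> = (x $ u)\<^sup>2"
      using deg[of u] by (simp add: y_def power_divide)
    finally show "(\<Sum>v\<in>UNIV. w u v * (y u)\<^sup>2) = (x $ u)\<^sup>2" .
  qed
  have "(\<Sum>u\<in>UNIV. \<Sum>v\<in>UNIV. w u v * (y v)\<^sup>2) = (\<Sum>v\<in>UNIV. \<Sum>u\<in>UNIV. w v u * (y v)\<^sup>2)"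
    by (subst sum.swap) (simp add: sym)
  with half have half': "(\<Sum>u\<in>UNIV. \<Sum>v\<in>UNIV. w u v * (y v)\<^sup>2) = (\<Sum>u\<in>UNIV. (x $ u)\<^sup>2)"
    by simp
  have "2 * (\<Sum>u\<in>UNIV. \<Sum>v\<in>UNIV. w u v * y u * y v)
      = (\<Sum>u\<in>UNIV. \<Sum>v\<in>UNIV. w u v * (2 * y u * y v))"
    by (simp add: sum_distrib_left mult_ac)
  also have "\<dots> \<le> (\<Sum>u\<in>UNIV. \<Sum>v\<in>UNIV. w u v * (y u)\<^sup>2 + w u v * (y v)\<^sup>2)"
  proof (intro sum_mono)
    show "w u v * (2 * y u * y v) \<le> w u v * (y u)\<^sup>2 + w u v * (y v)\<^sup>2" for u v
      using mult_left_mono[OF sum_squares_bound nn] by (simp add: algebra_simps)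
  qed
  also have "\<dots> = 2 * (\<Sum>u\<in>UNIV. (x $ u)\<^sup>2)"
    by (simp add: sum.distrib half half')
  finally show ?thesis
    by (simp add: laplacian_quadratic_form y_def)
qed

section \<open>The meta-graph and the lift of its vectors\<close>

text \<open>On the diagonal the factor 2 cancels the halving in \<open>edge_weight\<close>. Off it,
  \<open>edge_weight\<close> tests equality of sets, not of labels; nonempty fibres make the two
  tests agree.\<close>

lemma meta_graph_by_label:
  fixes s :: "'v::finite \<Rightarrow> 'k::finite"
  assumes "surj s"
  shows "meta_graph w (\<lambda>i. {u. s u = i}) i j = (\<Sum>u | s u = i. \<Sum>v | s v = j. w u v)"
proof (cases "i = j")
  case False
  then have "{u. s u = i} \<noteq> {u. s u = j}"
    using label_inj[OF assms] by (auto dest: injD)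
  with False show ?thesis
    by (simp add: meta_graph_def edge_weight_def)
qed (simp add: meta_graph_def edge_weight_def)

lemma deg_meta_graph:
  fixes s :: "'v::finite \<Rightarrow> 'k::finite"
  assumes "surj s"
  shows "deg (meta_graph w (\<lambda>i. {u. s u = i})) i = vol w {u. s u = i}"
proof -
  have "deg (meta_graph w (\<lambda>i. {u. s u = i})) i
      = (\<Sum>j\<in>UNIV. \<Sum>u | s u = i. \<Sum>v | s v = j. w u v)"
    by (simp add: deg_def meta_graph_by_label[OF assms])
  also have "\<dots> = (\<Sum>u | s u = i. \<Sum>j\<in>UNIV. \<Sum>v | s v = j. w u v)"
    by (rule sum.swap)
  finally show ?thesis
    by (simp add: sum_by_label vol_def deg_def)
qed

text \<open>The \<open>i\<close>-th unit vector goes to the indicator of cluster \<open>i\<close>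
  multiplied by square roots of degrees and normalised; these images have disjoint supports.\<close>

definition lift :: "('v::finite \<Rightarrow> 'v \<Rightarrow> real) \<Rightarrow> ('v \<Rightarrow> 'k::finite) \<Rightarrow> real^'k \<Rightarrow> real^'v" where
  "lift w s y = (\<chi> u. sqrt (deg w u) * y $ s u / sqrt (vol w {v. s v = s u}))"

lemma inner_lift:
  assumes w: "weighted_graph w" and s: "surj s"
  shows "lift w s x \<bullet> lift w s y = x \<bullet> y"
proof -
  have "lift w s x \<bullet> lift w s y
      = (\<Sum>i\<in>UNIV. \<Sum>u | s u = i. lift w s x $ u * lift w s y $ u)"
    unfolding sum_by_label by (simp add: inner_vec_def)
  also have "\<dots> = (\<Sum>i\<in>UNIV. \<Sum>u | s u = i. deg w u * (x $ i * y $ i / vol w {v. s v = i}))"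
  proof (intro sum.cong refl)
    fix i u assume "u \<in> {u. s u = i}"
    moreover have "0 \<le> deg w u" "0 \<le> vol w {v. s v = i}"
      using w by (auto simp: weighted_graph_def vol_def less_imp_le intro!: sum_nonneg)
    ultimately show "lift w s x $ u * lift w s y $ u = deg w u * (x $ i * y $ i / vol w {v. s v = i})"
      by (simp add: lift_def field_simps)
  qed
  also have "\<dots> = (\<Sum>i\<in>UNIV. vol w {u. s u = i} * (x $ i * y $ i / vol w {v. s v = i}))"
    by (simp only: vol_def sum_distrib_right)
  also have "\<dots> = (\<Sum>i\<in>UNIV. x $ i * y $ i)"
  proof (intro sum.cong refl)
    fix i
    show "vol w {u. s u = i} * (x $ i * y $ i / vol w {v. s v = i}) = x $ i * y $ i"
      using vol_pos[OF w label_nonempty[OF s, of i]] by simp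
  qed
  finally show ?thesis
    by (simp add: inner_vec_def)
qed

text \<open>Dividing the lift by the square roots of the degrees leaves a function constant on
  clusters. Its values are \<open>y\<close> divided by the square roots of the meta-degrees, which
  are the volumes, so the adjacency form groups into that of the meta-graph.\<close>

lemma laplacian_lift:
  assumes w: "weighted_graph w" and s: "surj s"
  shows "lift w s y \<bullet> (normalised_laplacian w *v lift w s y)
    = y \<bullet> (normalised_laplacian (meta_graph w (\<lambda>i. {u. s u = i})) *v y)"
proof -
  define z where "z i = y $ i / sqrt (vol w {v. s v = i})" for i
  have z: "lift w s y $ u / sqrt (deg w u) = z (s u)" for u
    using w by (simp add: lift_def z_def weighted_graph_def less_imp_neq[symmetric])
  have "(\<Sum>i\<in>UNIV. \<Sum>j\<in>UNIV. meta_graph w (\<lambda>i. {u. s u = i}) i j * z i * z j)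
      = (\<Sum>i\<in>UNIV. \<Sum>j\<in>UNIV. \<Sum>u | s u = i. \<Sum>v | s v = j. w u v * z (s u) * z (s v))"
    by (simp add: meta_graph_by_label[OF s] sum_distrib_right)
  also have "\<dots> = (\<Sum>i\<in>UNIV. \<Sum>u | s u = i. \<Sum>j\<in>UNIV. \<Sum>v | s v = j. w u v * z (s u) * z (s v))"
    by (intro sum.cong refl sum.swap)
  also have "\<dots> = (\<Sum>u\<in>UNIV. \<Sum>v\<in>UNIV. w u v * z (s u) * z (s v))"
    by (simp only: sum_by_label)
  finally have "(\<Sum>i\<in>UNIV. \<Sum>j\<in>UNIV. meta_graph w (\<lambda>i. {u. s u = i}) i j * z i * z j)
      = (\<Sum>u\<in>UNIV. \<Sum>v\<in>UNIV. w u v * z (s u) * z (s v))" .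
  moreover have "(\<Sum>u\<in>UNIV. (lift w s y $ u)\<^sup>2) = (\<Sum>i\<in>UNIV. (y $ i)\<^sup>2)"
    using inner_lift[OF w s, of y y] by (simp add: inner_vec_def power2_eq_square)
  ultimately show ?thesis
    unfolding laplacian_quadratic_form z deg_meta_graph[OF s] by (simp add: z_def)
qed

section \<open>The spectral embedding is close to the meta-graph embedding\<close>

text \<open>Pythagoras for the orthogonal projection to the span of \<open>G\<close>.\<close>

lemma norm_projection_defect:
  fixes G :: "nat \<Rightarrow> 'a::real_inner"
  assumes fin: "finite J"
    and on: "\<And>i j. i \<in> J \<Longrightarrow> j \<in> J \<Longrightarrow> G i \<bullet> G j = (if i = j then 1 else 0)"
  shows "(norm (x - (\<Sum>j\<in>J. (x \<bullet> G j) *\<^sub>R G j)))\<^sup>2 = x \<bullet> x - (\<Sum>j\<in>J. (x \<bullet> G j)\<^sup>2)"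
proof -
  define y where "y = (\<Sum>j\<in>J. (x \<bullet> G j) *\<^sub>R G j)"
  have Gy: "G j \<bullet> y = x \<bullet> G j" if "j \<in> J" for j
    using that fin by (simp add: y_def inner_sum_right on if_distrib sum.delta' cong: if_cong)
  have xy: "x \<bullet> y = (\<Sum>j\<in>J. (x \<bullet> G j)\<^sup>2)"
    by (simp add: y_def inner_sum_right power2_eq_square)
  have "y \<bullet> y = (\<Sum>j\<in>J. (x \<bullet> G j) * (G j \<bullet> y))"
    by (subst (1) y_def) (simp add: inner_sum_left)
  also have "\<dots> = (\<Sum>j\<in>J. (x \<bullet> G j)\<^sup>2)"
    by (simp add: Gy power2_eq_square)
  finally show ?thesis
    using xy unfolding y_def[symmetric]
    by (simp add: power2_norm_eq_inner inner_diff_left inner_diff_right inner_commute[of y x])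
qed

text \<open>Both sides are the size of \<open>J\<close> minus the same double sum of squared inner
  products. This trades closeness of the lifts to the eigenvectors for closeness of the eigenvectors
  to the lifts.\<close>

lemma projection_defect_swap:
  fixes f G :: "nat \<Rightarrow> 'a::real_inner"
  assumes fin: "finite J"
    and f: "\<And>i. i \<in> J \<Longrightarrow> f i \<bullet> f i = 1"
    and G: "\<And>i j. i \<in> J \<Longrightarrow> j \<in> J \<Longrightarrow> G i \<bullet> G j = (if i = j then 1 else 0)"
  shows "(\<Sum>m\<in>J. (norm (f m - (\<Sum>j\<in>J. (f m \<bullet> G j) *\<^sub>R G j)))\<^sup>2)
    = (\<Sum>j\<in>J. 1 - (\<Sum>m\<in>J. (f m \<bullet> G j)\<^sup>2))"
proof -
  have "(\<Sum>m\<in>J. \<Sum>j\<in>J. (f m \<bullet> G j)\<^sup>2) = (\<Sum>j\<in>J. \<Sum>m\<in>J. (f m \<bullet> G j)\<^sup>2)"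
    by (rule sum.swap)
  then show ?thesis
    by (simp add: norm_projection_defect[OF fin G] f sum_subtractf)
qed

text \<open>By Cauchy-Schwarz the tail of a combination of the \<open>G j\<close> is at most
  \<open>\<psi>\<close> times its squared norm; Parseval leaves the rest to the first
  \<open>l\<close> eigenvectors.\<close>

lemma eigensystem_head_combination_ge:
  fixes f G :: "nat \<Rightarrow> real^'n"
  assumes es: "orthonormal_eigensystem N ev f" and l: "l < CARD('n)" and fin: "finite J"
    and G: "\<And>i j. i \<in> J \<Longrightarrow> j \<in> J \<Longrightarrow> G i \<bullet> G j = (if i = j then 1 else 0)"
    and tail: "(\<Sum>j\<in>J. \<Sum>m=l+1..CARD('n). (f m \<bullet> G j)\<^sup>2) \<le> \<psi>"
  shows "(1 - \<psi>) * (\<Sum>j\<in>J. (v j)\<^sup>2) \<le> (\<Sum>m=1..l. (f m \<bullet> (\<Sum>j\<in>J. v j *\<^sub>R G j))\<^sup>2)"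
proof -
  define h where "h = (\<Sum>j\<in>J. v j *\<^sub>R G j)"
  have "G i \<bullet> h = v i" if "i \<in> J" for i
    using that fin by (simp add: h_def inner_sum_right G if_distrib sum.delta' cong: if_cong)
  then have hh: "h \<bullet> h = (\<Sum>j\<in>J. (v j)\<^sup>2)"
    by (subst (1) h_def) (simp add: inner_sum_left power2_eq_square)
  have "(\<Sum>m=l+1..CARD('n). (f m \<bullet> h)\<^sup>2)
      \<le> (\<Sum>m=l+1..CARD('n). (\<Sum>j\<in>J. (v j)\<^sup>2) * (\<Sum>j\<in>J. (f m \<bullet> G j)\<^sup>2))"
    by (intro sum_mono) (simp add: h_def inner_sum_right Cauchy_Schwarz_ineq_sum)
  also have "\<dots> = (\<Sum>j\<in>J. (v j)\<^sup>2) * (\<Sum>j\<in>J. \<Sum>m=l+1..CARD('n). (f m \<bullet> G j)\<^sup>2)"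
    by (subst sum.swap) (simp only: sum_distrib_left)
  also have "\<dots> \<le> (\<Sum>j\<in>J. (v j)\<^sup>2) * \<psi>"
    using tail by (intro mult_left_mono sum_nonneg) auto
  finally show ?thesis
    using eigensystem_head_tail[OF es l, of h] unfolding h_def[symmetric] hh
    by (simp add: algebra_simps)
qed

text \<open>
  The projection of \<open>f m\<close> to the span of \<open>lift (g 1), \<dots>, lift (g l)\<close>, divided entrywise by the square
  roots of the degrees, is constant on every cluster; this constant is the \<open>m\<close>-th coordinate of the centre.
\<close>

definition ideal_centre ::
    "('v::finite \<Rightarrow> 'v \<Rightarrow> real) \<Rightarrow> ('v \<Rightarrow> 'k::finite) \<Rightarrow> (nat \<Rightarrow> real^'v) \<Rightarrow> (nat \<Rightarrow> real^'k) \<Rightarrow>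
      nat \<Rightarrow> 'k \<Rightarrow> nat \<Rightarrow> real" where
  "ideal_centre w s f g l i m =
     f m \<bullet> (\<Sum>j=1..l. (g j $ i / sqrt (vol w {u. s u = i})) *\<^sub>R lift w s (g j))"

context
  fixes w :: "'v::finite \<Rightarrow> 'v \<Rightarrow> real" and s :: "'v \<Rightarrow> 'k::finite"
    and lam gam :: "nat \<Rightarrow> real" and f :: "nat \<Rightarrow> real^'v" and g :: "nat \<Rightarrow> real^'k" and l :: nat
  assumes w: "weighted_graph w" and s: "surj s"
    and f: "orthonormal_eigensystem (normalised_laplacian w) lam f"
    and g: "orthonormal_eigensystem (normalised_laplacian (meta_graph w (\<lambda>i. {u. s u = i}))) gam g"
    and lk: "l \<le> CARD('k)" and lv: "l < CARD('v)" and lam: "0 < lam (l + 1)"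
begin

lemma lift_orthonormal:
  assumes "i \<in> {1..l}" "j \<in> {1..l}"
  shows "lift w s (g i) \<bullet> lift w s (g j) = (if i = j then 1 else 0)"
  using assms g lk by (simp add: inner_lift[OF w s] orthonormal_eigensystem_def)

text \<open>The lift of \<open>g j\<close> has quadratic form \<open>gam j\<close>, so its tail is
  at most the \<open>j\<close>-th summand of \<open>Psi\<close>.\<close>

lemma lift_tail_le_Psi:
  "(\<Sum>j=1..l. \<Sum>m=l+1..CARD('v). (f m \<bullet> lift w s (g j))\<^sup>2) \<le> Psi lam gam l"
  unfolding Psi_def
proof (rule sum_mono)
  fix j assume j: "j \<in> {1..l}"
  then have "lift w s (g j) \<bullet> (normalised_laplacian w *v lift w s (g j)) = gam j"
    using g lk by (simp add: laplacian_lift[OF w s] orthonormal_eigensystem_def)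
  then show "(\<Sum>m=l+1..CARD('v). (f m \<bullet> lift w s (g j))\<^sup>2) \<le> gam j / lam (l + 1)"
    using eigensystem_tail_le[OF f laplacian_psd[OF w] lv lam, of "lift w s (g j)"] by simp
qed

lemma Psi_nonneg: "0 \<le> Psi lam gam l"
  by (rule order_trans[OF _ lift_tail_le_Psi]) (intro sum_nonneg, simp)

text \<open>Scaled by \<open>sqrt (deg w u)\<close>, the deviation in coordinate \<open>m\<close> is
  entry \<open>u\<close> of \<open>f m\<close> minus its projection to the lifts. The cost is
  therefore the total projection defect, which the swap turns into the tails of the lifts.\<close>

lemma ideal_centre_cost:
  "(\<Sum>u\<in>UNIV. deg w u *
      (L2_set (\<lambda>m. spectral_embedding w f u m - ideal_centre w s f g l (s u) m) {1..l})\<^sup>2)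
    \<le> Psi lam gam l"
proof -
  let ?G = "\<lambda>j. lift w s (g j)"
  have pt: "deg w u * (spectral_embedding w f u m - ideal_centre w s f g l (s u) m)\<^sup>2
      = ((f m - (\<Sum>j=1..l. (f m \<bullet> ?G j) *\<^sub>R ?G j)) $ u)\<^sup>2" for u m
  proof -
    have d: "0 < deg w u"
      using w by (simp add: weighted_graph_def)
    have "sqrt (deg w u) * ideal_centre w s f g l (s u) m = (\<Sum>j=1..l. (f m \<bullet> ?G j) *\<^sub>R ?G j) $ u"
      by (simp add: ideal_centre_def inner_sum_right sum_distrib_left lift_def mult_ac)
    then have "sqrt (deg w u) * (spectral_embedding w f u m - ideal_centre w s f g l (s u) m)
        = (f m - (\<Sum>j=1..l. (f m \<bullet> ?G j) *\<^sub>R ?G j)) $ u"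
      using d by (simp add: spectral_embedding_def right_diff_distrib)
    then have "((f m - (\<Sum>j=1..l. (f m \<bullet> ?G j) *\<^sub>R ?G j)) $ u)\<^sup>2
        = (sqrt (deg w u) * (spectral_embedding w f u m - ideal_centre w s f g l (s u) m))\<^sup>2"
      by simp
    then show ?thesis
      using d by (simp only: power_mult_distrib real_sqrt_pow2 less_imp_le)
  qed
  have "(\<Sum>u\<in>UNIV. deg w u *
      (L2_set (\<lambda>m. spectral_embedding w f u m - ideal_centre w s f g l (s u) m) {1..l})\<^sup>2)
    = (\<Sum>u\<in>UNIV. \<Sum>m=1..l. ((f m - (\<Sum>j=1..l. (f m \<bullet> ?G j) *\<^sub>R ?G j)) $ u)\<^sup>2)"
    by (simp only: L2_set_power2 sum_distrib_left pt)
  also have "\<dots> = (\<Sum>m=1..l. (norm (f m - (\<Sum>j=1..l. (f m \<bullet> ?G j) *\<^sub>R ?G j)))\<^sup>2)"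
    by (subst sum.swap) (simp only: norm_vec_def L2_set_power2 real_norm_def power2_abs)
  also have "\<dots> = (\<Sum>j=1..l. 1 - (\<Sum>m=1..l. (f m \<bullet> ?G j)\<^sup>2))"
    using f lv lift_orthonormal
    by (intro projection_defect_swap) (auto simp: orthonormal_eigensystem_def)
  also have "\<dots> = (\<Sum>j=1..l. \<Sum>m=l+1..CARD('v). (f m \<bullet> ?G j)\<^sup>2)"
  proof (intro sum.cong refl)
    fix j assume "j \<in> {1..l}"
    then show "1 - (\<Sum>m=1..l. (f m \<bullet> ?G j)\<^sup>2) = (\<Sum>m=l+1..CARD('v). (f m \<bullet> ?G j)\<^sup>2)"
      using eigensystem_head_tail[OF f lv, of "?G j"] lift_orthonormal[of j j] by simp
  qed
  also have "\<dots> \<le> Psi lam gam l"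
    by (rule lift_tail_le_Psi)
  finally show ?thesis .
qed

text \<open>A difference of centres lists the first \<open>l\<close> coefficients of one combination
  of lifts, so projecting costs at most the factor \<open>1 - Psi lam gam l\<close>.\<close>

lemma ideal_centre_dist_ge:
  "(1 - Psi lam gam l) *
     (L2_set (\<lambda>m. g m $ i / sqrt (vol w {u. s u = i}) - g m $ j / sqrt (vol w {u. s u = j})) {1..l})\<^sup>2
    \<le> (L2_set (\<lambda>m. ideal_centre w s f g l i m - ideal_centre w s f g l j m) {1..l})\<^sup>2"
proof -
  have "ideal_centre w s f g l i m - ideal_centre w s f g l j m
    = f m \<bullet> (\<Sum>r=1..l. (g r $ i / sqrt (vol w {u. s u = i}) - g r $ j / sqrt (vol w {u. s u = j}))
        *\<^sub>R lift w s (g r))" for m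
    by (simp only: ideal_centre_def scaleR_left_diff_distrib sum_subtractf inner_diff_right)
  then show ?thesis
    unfolding L2_set_power2
    using eigensystem_head_combination_ge[OF f lv _ lift_orthonormal lift_tail_le_Psi] by simp
qed

end

section \<open>Consequences of distinguishability\<close>

text \<open>By Parseval for a coordinate vector, the \<open>i\<close>-th entries of all the
  \<open>g m\<close> have squares summing to 1; the embedding keeps only the first \<open>l\<close>
  of them.\<close>

lemma distinguishable_le_1:
  fixes g :: "nat \<Rightarrow> real^'k::finite"
  assumes "distinguishable \<theta> l g" "orthonormal_eigensystem N gam g" "l \<le> CARD('k)"
  shows "\<theta> \<le> 1"
proof -
  fix i :: 'k
  have "\<theta> \<le> (\<Sum>m=1..l. (g m $ i)\<^sup>2)"
    using assms(1) by (simp add: distinguishable_def L2_set_power2 meta_embedding_def)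
  also have "\<dots> \<le> (\<Sum>m=1..CARD('k). (g m $ i)\<^sup>2)"
    using assms(3) by (intro sum_mono2) auto
  also have "\<dots> = (\<Sum>m=1..CARD('k). (g m \<bullet> axis i 1)\<^sup>2)"
    by (simp add: inner_axis)
  also have "\<dots> = 1"
    using assms(2) by (subst orthonormal_parseval) (auto simp: orthonormal_eigensystem_def inner_axis)
  finally show ?thesis .
qed

text \<open>Positive scaling preserves directions, so Dunkl-Williams applies with a first norm of at
  least \<open>sqrt (\<theta> / a)\<close> and a gap between directions of at least
  \<open>sqrt \<theta>\<close>.\<close>

lemma distinguishable_scaled_dist_ge:
  fixes g :: "nat \<Rightarrow> real^'k::finite"
  assumes dist: "distinguishable \<theta> l g" and "i \<noteq> j" and pos: "0 < a" "0 < b"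
  shows "\<theta>\<^sup>2 / (4 * a) \<le> (L2_set (\<lambda>m. g m $ i / sqrt a - g m $ j / sqrt b) {1..l})\<^sup>2"
proof -
  let ?I = "{1..l}"
  let ?x = "\<lambda>m. g m $ i" and ?y = "\<lambda>m. g m $ j"
  have \<theta>: "0 < \<theta>" and nx: "\<theta> \<le> (L2_set ?x ?I)\<^sup>2" and ny: "\<theta> \<le> (L2_set ?y ?I)\<^sup>2"
    and sep: "\<theta> \<le> (L2_set (\<lambda>m. ?x m / L2_set ?x ?I - ?y m / L2_set ?y ?I) ?I)\<^sup>2"
    using dist \<open>i \<noteq> j\<close> unfolding distinguishable_def meta_embedding_def by blast+
  have "0 < L2_set ?x ?I" "0 < L2_set ?y ?I"
    using \<theta> nx ny L2_set_nonneg[of ?x ?I] L2_set_nonneg[of ?y ?I] by (auto simp: less_le)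
  moreover have sx: "L2_set (\<lambda>m. ?x m / sqrt a) ?I = L2_set ?x ?I / sqrt a"
    and sy: "L2_set (\<lambda>m. ?y m / sqrt b) ?I = L2_set ?y ?I / sqrt b"
    using L2_set_scale[of "1 / sqrt a" ?x ?I] L2_set_scale[of "1 / sqrt b" ?y ?I] pos by simp_all
  ultimately have "L2_set ?x ?I / sqrt a * L2_set (\<lambda>m. ?x m / L2_set ?x ?I - ?y m / L2_set ?y ?I) ?I
      \<le> 2 * L2_set (\<lambda>m. ?x m / sqrt a - ?y m / sqrt b) ?I"
    using L2_set_dunkl_williams[of "\<lambda>m. ?x m / sqrt a" ?I "\<lambda>m. ?y m / sqrt b"] pos by simp
  then have "(L2_set ?x ?I / sqrt a * L2_set (\<lambda>m. ?x m / L2_set ?x ?I - ?y m / L2_set ?y ?I) ?I)\<^sup>2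
      \<le> (2 * L2_set (\<lambda>m. ?x m / sqrt a - ?y m / sqrt b) ?I)\<^sup>2"
    using pos by (intro power_mono) (auto intro!: mult_nonneg_nonneg divide_nonneg_nonneg)
  then have le: "(L2_set ?x ?I)\<^sup>2 / a * (L2_set (\<lambda>m. ?x m / L2_set ?x ?I - ?y m / L2_set ?y ?I) ?I)\<^sup>2
      \<le> 4 * (L2_set (\<lambda>m. ?x m / sqrt a - ?y m / sqrt b) ?I)\<^sup>2"
    using pos by (simp add: power_mult_distrib power_divide)
  have "\<theta> / a * \<theta> \<le> (L2_set ?x ?I)\<^sup>2 / a * (L2_set (\<lambda>m. ?x m / L2_set ?x ?I - ?y m / L2_set ?y ?I) ?I)\<^sup>2"
    using nx sep \<theta> pos by (intro mult_mono divide_right_mono) auto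
  with le have "\<theta> / a * \<theta> \<le> 4 * (L2_set (\<lambda>m. ?x m / sqrt a - ?y m / sqrt b) ?I)\<^sup>2"
    by linarith
  then show ?thesis
    using pos by (simp add: power2_eq_square field_simps)
qed

section \<open>Misclassified volume of spectral clustering\<close>

theorem theorem4:
  fixes w :: "'v::finite \<Rightarrow> 'v \<Rightarrow> real"
    and S A :: "'k::finite \<Rightarrow> 'v set"
    and lam gam :: "nat \<Rightarrow> real"
    and f :: "nat \<Rightarrow> real^'v"
    and g :: "nat \<Rightarrow> real^'k"
    and l :: nat
    and \<theta> APT :: real
  assumes "weighted_graph w"
    and "orthonormal_eigensystem (normalised_laplacian w) lam f"
    and "indexed_partition S"
    and "Max (range (\<lambda>i. conductance w (S i))) = rho w CARD('k)"
    and "\<And>i. 1 / 2 * vol w UNIV / real CARD('k) \<le> vol w (S i)"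
    and "\<And>i. vol w (S i) \<le> 2 * vol w UNIV / real CARD('k)"
    and "1 \<le> l" and "l \<le> CARD('k)" and "l < CARD('v)"
    and "orthonormal_eigensystem (normalised_laplacian (meta_graph w S)) gam g"
    and "distinguishable \<theta> l g"
    and "0 < lam (l + 1)"
    and "1 \<le> APT"
    and "Psi lam gam l \<le> inverse (2176 * (1 + APT)) * \<theta> ^ 3"
    and "spectral_clustering_output w f l APT A"
  shows "\<exists>\<pi>. \<pi> permutes (UNIV :: 'k set) \<and>
    (\<Sum>i\<in>UNIV. vol w (sym_diff (A i) (S (\<pi> i))))
      \<le> 2176 * (1 + APT) * (Psi lam gam l * vol w UNIV / (real CARD('k) * \<theta>\<^sup>2))"
proof -
  note w = assms(1) and f = assms(2) and APT = assms(13)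
  obtain s where S: "S = (\<lambda>i. {u. s u = i})" and s: "surj s"
    using indexed_partition_labelling[OF assms(3)] .
  have "indexed_partition A"
    using assms(15) by (simp add: spectral_clustering_output_def)
  then obtain a where A: "A = (\<lambda>i. {u. a u = i})" and a: "surj a"
    using indexed_partition_labelling by blast
  have partS: "indexed_partition (\<lambda>i. {u. s u = i})"
    using assms(3) S by simp
  have g: "orthonormal_eigensystem (normalised_laplacian (meta_graph w (\<lambda>i. {u. s u = i}))) gam g"
    using assms(10) S by simp
  note ctx = w s f g assms(8,9,12)

  define \<Psi> where "\<Psi> = Psi lam gam l"
  define K where "K = real CARD('k)"
  define V where "V = vol w UNIV"
  \<comment> \<open>The 16 is 4 from the scaled distance, times 2 from the upper volume bound, times
    2 from \<open>1 - \<Psi> \<ge> 1 / 2\<close>.\<close>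
  define \<Delta> where "\<Delta> = K * \<theta>\<^sup>2 / (16 * V)"
  let ?F = "spectral_embedding w f" and ?p = "ideal_centre w s f g l"
  let ?c = "\<lambda>i. weighted_mean w ?F {v. a v = i}"
  have K: "0 < K" and V: "0 < V"
    using vol_pos[OF w, of UNIV] by (auto simp: K_def V_def)
  have \<theta>: "0 < \<theta>" "\<theta> \<le> 1"
    using assms(11) distinguishable_le_1[OF assms(11,10,8)] by (auto simp: distinguishable_def)
  have \<Delta>: "0 < \<Delta>"
    using K V \<theta> by (simp add: \<Delta>_def)
  have \<Psi>0: "0 \<le> \<Psi>"
    unfolding \<Psi>_def by (rule Psi_nonneg[OF ctx])
  have \<Psi>: "2176 * (1 + APT) * \<Psi> \<le> \<theta> ^ 3"
    using assms(14) APT by (simp add: \<Psi>_def field_simps)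
  have "\<theta> ^ 3 \<le> 1"
    using \<theta> by (simp add: power_le_one)
  moreover have "2 * \<Psi> \<le> 2176 * (1 + APT) * \<Psi>"
    using APT \<Psi>0 by (intro mult_right_mono) auto
  ultimately have \<Psi>_half: "\<Psi> \<le> 1 / 2"
    using \<Psi> by linarith

  have d: "0 \<le> deg w u" for u
    using w by (simp add: weighted_graph_def less_imp_le)
  have cost_s: "(\<Sum>u\<in>UNIV. deg w u * (L2_set (\<lambda>m. ?F u m - ?p (s u) m) {1..l})\<^sup>2) \<le> \<Psi>"
    unfolding \<Psi>_def by (rule ideal_centre_cost[OF ctx])
  have "(\<Sum>u\<in>UNIV. deg w u * (L2_set (\<lambda>m. ?F u m - ?c (a u) m) {1..l})\<^sup>2)
      \<le> APT * kmeans_opt w l ?F CARD('k)"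
    using assms(15) by (simp add: spectral_clustering_output_def A kmeans_cost_by_label[OF a])
  \<comment> \<open>The optimum is compared with the clusters of \<open>S\<close> around their ideal
    centres.\<close>
  also have "\<dots> \<le> APT * \<Psi>"
    using APT kmeans_opt_le[OF w s partS, of l ?F ?p] cost_s by (intro mult_left_mono) auto
  finally have cost_a:
    "(\<Sum>u\<in>UNIV. deg w u * (L2_set (\<lambda>m. ?F u m - ?c (a u) m) {1..l})\<^sup>2) \<le> APT * \<Psi>" .
  have sep: "\<Delta> \<le> (L2_set (\<lambda>m. ?p i m - ?p j m) {1..l})\<^sup>2" if "i \<noteq> j" for i j
  proof -
    let ?vi = "vol w {u. s u = i}" and ?vj = "vol w {u. s u = j}"
    have pos: "0 < ?vi" "0 < ?vj"
      by (intro vol_pos[OF w] label_nonempty[OF s])+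
    have "?vi \<le> 2 * V / K"
      using assms(6)[of i] by (simp add: S V_def K_def)
    then have "\<theta>\<^sup>2 / (4 * (2 * V / K)) \<le> \<theta>\<^sup>2 / (4 * ?vi)"
      using pos by (intro divide_left_mono mult_left_mono mult_pos_pos) (use K V in auto)
    also have "\<dots> \<le> (L2_set (\<lambda>m. g m $ i / sqrt ?vi - g m $ j / sqrt ?vj) {1..l})\<^sup>2"
      by (rule distinguishable_scaled_dist_ge[OF assms(11) that pos])
    finally have "1 / 2 * (\<theta>\<^sup>2 / (4 * (2 * V / K)))
        \<le> (1 - \<Psi>) * (L2_set (\<lambda>m. g m $ i / sqrt ?vi - g m $ j / sqrt ?vj) {1..l})\<^sup>2"
      using \<Psi>_half K V by (intro mult_mono) auto
    also have "\<dots> \<le> (L2_set (\<lambda>m. ?p i m - ?p j m) {1..l})\<^sup>2"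
      unfolding \<Psi>_def by (rule ideal_centre_dist_ge[OF ctx])
    finally show ?thesis
      by (simp add: \<Delta>_def mult_ac)
  qed
  have bound: "8 * (\<Psi> + APT * \<Psi>) / \<Delta> = 128 * ((1 + APT) * (\<Psi> * V / (K * \<theta>\<^sup>2)))"
    by (simp add: \<Delta>_def algebra_simps add_divide_distrib)
  \<comment> \<open>Since 2176 = 17 * 128, the hypothesis on \<open>\<Psi>\<close> applies directly.
    Two of the three powers of \<open>\<theta>\<close> cancel against \<open>\<Delta>\<close>, the
    third is at most 1, and \<open>V / (17 * K)\<close> lies below the lower volume bound.\<close>
  have large: "8 * (\<Psi> + APT * \<Psi>) / \<Delta> < (\<Sum>u | s u = j. deg w u)" for j
  proof -
    have "8 * (\<Psi> + APT * \<Psi>) / \<Delta> = (2176 * (1 + APT) * \<Psi>) * (V / (17 * K * \<theta>\<^sup>2))"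
      unfolding bound by (simp add: divide_simps)
    also have "\<dots> \<le> \<theta> ^ 3 * (V / (17 * K * \<theta>\<^sup>2))"
      using \<Psi> K V by (intro mult_right_mono) auto
    also have "\<dots> = \<theta> * (V / (17 * K))"
      using \<theta> by (simp add: power2_eq_square power3_eq_cube)
    also have "\<dots> \<le> 1 * (V / (17 * K))"
      using \<theta> K V by (intro mult_right_mono) auto
    also have "\<dots> < 1 / 2 * V / K"
      using K V by (simp add: field_simps)
    also have "\<dots> \<le> (\<Sum>u | s u = j. deg w u)"
      using assms(5)[of j] by (simp add: S V_def K_def vol_def)
    finally show ?thesis .
  qed
  obtain \<pi> where \<pi>: "\<pi> permutes (UNIV :: 'k set)"
    and mis: "(\<Sum>u | s u \<noteq> \<pi> (a u). deg w u) \<le> 8 * (\<Psi> + APT * \<Psi>) / \<Delta>"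
    using matching_of_clusterings[OF d \<Delta> cost_s cost_a sep large] by blast
  have "(\<Sum>i\<in>UNIV. vol w (sym_diff (A i) (S (\<pi> i)))) \<le> 2 * (\<Sum>u | s u \<noteq> \<pi> (a u). deg w u)"
    unfolding vol_def A S by (rule sum_weight_sym_diff_le[OF d \<pi>])
  \<comment> \<open>Counting each misplaced vertex twice doubles 128 to 256, which is within the
    stated constant.\<close>
  also have "\<dots> \<le> 256 * ((1 + APT) * (\<Psi> * V / (K * \<theta>\<^sup>2)))"
    using mis unfolding bound by linarith
  also have "\<dots> \<le> 2176 * ((1 + APT) * (\<Psi> * V / (K * \<theta>\<^sup>2)))"
    using APT \<Psi>0 K V by (intro mult_right_mono) auto
  finally show ?thesis
    using \<pi> unfolding \<Psi>_def V_def K_def mult.assoc by blast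
qed

end
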